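(* Let $\mathbf{B}$ be a finite relational structure, let $F$ be an encoding for $\mathbf{B}$ with underlying finite set $D$, and let $\sigma=(\rho,\tau)$ be an inner symmetry of $\mathbf{B}$ and $F$. Let $V$ be a non-empty finite set. For any map $u: A_{V,F}\to B$, define $u': A_{V,F}\to B$ by $u'(\alpha)=u(\widetilde{\sigma}(\alpha))$. Then $u\in\langle T_V\rangle_{\mathbf{B}}$ if and only if $u'\in\langle T_V\rangle_{\mathbf{B}}$.
   Context: Structures have a finite signature and finite universe. A $\wedge$-formula is a conjunction of atoms $R(v_1,\dots,v_k)$ and variable equalities with the usual satisfaction over $\mathbf{B}$. For a finite set $S$, a set of maps $S\to B$ is $\wedge$-definable if it is the set of satisfying assignments $S\to B$ of a $\wedge$-formula with variables from $S$; $\langle T\rangle_{\mathbf{B}}$ is the smallest $\wedge$-definable set of maps containing $T$. An automorphism of $\mathbf{B}$ is a bijection of $B$ preserving each relation in both directions. An encoding: finite set $D$ and finite set $F$ of maps $f: D^k\to B$, $k\ge 0$ the arity ($D^0$ contains only the empty tuple). For a finite set $V$: $G_{V,D}$ = all maps $V\to D$; a $(V,F)$-application is a pair $(\bar v,f)$, $f\in F$, $\bar v$ a tuple over $V$ of length the arity of $f$; $A_{V,F}$ the set of them; for $g\in G_{V,D}$, $\alpha=((v_1,\dots,v_k),f)$, $\alpha[g]=f(g(v_1),\dots,g(v_k))$; $t[g]:\alpha\mapsto\alpha[g]$; $T_V=\{t[g]\mid g\in G_{V,D}\}$. An inner symmetry (relative to $\mathbf{B}$ and $F$) is a pair $\sigma=(\rho,\tau)$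 where $\rho: D\to D$ is a bijection and $\tau: B\to B$ is an automorphism of $\mathbf{B}$, such that $F=\{\widetilde{\sigma}(f)\mid f\in F\}$, where for $g: D^k\to B$, $\widetilde{\sigma}(g)=\tau\circ g\circ(\rho,\dots,\rho)$ with $(\rho,\dots,\rho)$ applying $\rho$ to each coordinate. For an application $\alpha=(\bar v,f)$, $\widetilde{\sigma}(\alpha)=(\bar v,\widetilde{\sigma}(f))$. *)

theory Defs
  imports "HOL-Library.FuncSet" "HOL-Library.NList"
begin

text \<open>
  Maps \<open>S \<rightarrow> B\<close> between sets are extensional functions, i.e. elements of \<open>S \<rightarrow>\<^sub>E B\<close>, and
  tuples in \<open>D\<^sup>k\<close> are lists in \<open>nlists k D\<close>.
\<close>

record ('b, 'r) rel_structure =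
  universe :: "'b set"
  symbols :: "'r set"
  arity :: "'r \<Rightarrow> nat"
  interp :: "'r \<Rightarrow> 'b list set"

definition finite_structure :: "('b, 'r) rel_structure \<Rightarrow> bool" where
  "finite_structure B \<longleftrightarrow> finite (universe B) \<and> finite (symbols B) \<and>
     (\<forall>R \<in> symbols B. interp B R \<subseteq> nlists (arity B R) (universe B))"

definition automorphism :: "('b, 'r) rel_structure \<Rightarrow> ('b \<Rightarrow> 'b) \<Rightarrow> bool" where
  "automorphism B \<tau> \<longleftrightarrow> bij_betw \<tau> (universe B) (universe B) \<and>
     (\<forall>R \<in> symbols B. \<forall>xs \<in> nlists (arity B R) (universe B). xs \<in> interp B R \<longleftrightarrow> map \<tau> xs \<in> interp B R)"

datatype ('r, 'x) atom = Rel 'r "'x list" | Eq 'x 'x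

primrec wf_atom :: "('b, 'r) rel_structure \<Rightarrow> 'x set \<Rightarrow> ('r, 'x) atom \<Rightarrow> bool" where
  "wf_atom B S (Rel R vs) \<longleftrightarrow> R \<in> symbols B \<and> vs \<in> nlists (arity B R) S"
| "wf_atom B S (Eq x y) \<longleftrightarrow> x \<in> S \<and> y \<in> S"

primrec sat_atom :: "('b, 'r) rel_structure \<Rightarrow> ('x \<Rightarrow> 'b) \<Rightarrow> ('r, 'x) atom \<Rightarrow> bool" where
  "sat_atom B h (Rel R vs) \<longleftrightarrow> map h vs \<in> interp B R"
| "sat_atom B h (Eq x y) \<longleftrightarrow> h x = h y"

text \<open>
  A \<open>\<and>\<close>-formula is the list of its conjuncts. The empty conjunction (true) is admitted, so that
  there is a \<open>\<and>\<close>-formula even over the empty set of variables.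
\<close>

definition wedge_formula :: "('b, 'r) rel_structure \<Rightarrow> 'x set \<Rightarrow> ('r, 'x) atom list \<Rightarrow> bool" where
  "wedge_formula B S \<phi> \<longleftrightarrow> (\<forall>a \<in> set \<phi>. wf_atom B S a)"

definition sat :: "('b, 'r) rel_structure \<Rightarrow> ('x \<Rightarrow> 'b) \<Rightarrow> ('r, 'x) atom list \<Rightarrow> bool" where
  "sat B h \<phi> \<longleftrightarrow> (\<forall>a \<in> set \<phi>. sat_atom B h a)"

definition wedge_definable :: "('b, 'r) rel_structure \<Rightarrow> 'x set \<Rightarrow> ('x \<Rightarrow> 'b) set \<Rightarrow> bool" where
  "wedge_definable B S X \<longleftrightarrow> (\<exists>\<phi>. wedge_formula B S \<phi> \<and> X = {h \<in> S \<rightarrow>\<^sub>E universe B. sat B h \<phi>})"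

definition wedge_closure :: "('b, 'r) rel_structure \<Rightarrow> 'x set \<Rightarrow> ('x \<Rightarrow> 'b) set \<Rightarrow> ('x \<Rightarrow> 'b) set" where
  "wedge_closure B S T = (LEAST X. wedge_definable B S X \<and> T \<subseteq> X)"

text \<open>
  An encoding map \<open>D\<^sup>k \<rightarrow> B\<close> carries its arity explicitly, as a pair \<open>(k, f)\<close>: an extensional
  function on lists does not determine its domain, hence not its arity.
\<close>

type_synonym ('d, 'b) enc_map = "nat \<times> ('d list \<Rightarrow> 'b)"

definition encoding :: "('b, 'r) rel_structure \<Rightarrow> 'd set \<Rightarrow> ('d, 'b) enc_map set \<Rightarrow> bool" where
  "encoding B D F \<longleftrightarrow> finite D \<and> finite F \<and> (\<forall>(k, f) \<in> F. f \<in> nlists k D \<rightarrow>\<^sub>E universe B)"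

definition assignments :: "'v set \<Rightarrow> 'd set \<Rightarrow> ('v \<Rightarrow> 'd) set" where
  "assignments V D = V \<rightarrow>\<^sub>E D"

type_synonym ('v, 'd, 'b) application = "'v list \<times> ('d, 'b) enc_map"

definition applications :: "'v set \<Rightarrow> ('d, 'b) enc_map set \<Rightarrow> ('v, 'd, 'b) application set" where
  "applications V F = {(vs, (k, f)) | vs k f. (k, f) \<in> F \<and> vs \<in> nlists k V}"

fun app_value :: "('v \<Rightarrow> 'd) \<Rightarrow> ('v, 'd, 'b) application \<Rightarrow> 'b" where
  "app_value g (vs, (k, f)) = f (map g vs)"

definition t_map :: "'v set \<Rightarrow> ('d, 'b) enc_map set \<Rightarrow> ('v \<Rightarrow> 'd) \<Rightarrow> ('v, 'd, 'b) application \<Rightarrow> 'b" where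
  "t_map V F g = restrict (app_value g) (applications V F)"

definition T_set :: "'v set \<Rightarrow> 'd set \<Rightarrow> ('d, 'b) enc_map set \<Rightarrow> (('v, 'd, 'b) application \<Rightarrow> 'b) set" where
  "T_set V D F = {t_map V F g | g. g \<in> assignments V D}"

fun sym_map :: "'d set \<Rightarrow> ('d \<Rightarrow> 'd) \<times> ('b \<Rightarrow> 'b) \<Rightarrow> ('d, 'b) enc_map \<Rightarrow> ('d, 'b) enc_map" where
  "sym_map D (\<rho>, \<tau>) (k, f) = (k, \<lambda>xs \<in> nlists k D. \<tau> (f (map \<rho> xs)))"

fun sym_app :: "'d set \<Rightarrow> ('d \<Rightarrow> 'd) \<times> ('b \<Rightarrow> 'b) \<Rightarrow>
    ('v, 'd, 'b) application \<Rightarrow> ('v, 'd, 'b) application" where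
  "sym_app D \<sigma> (vs, f) = (vs, sym_map D \<sigma> f)"

fun inner_symmetry :: "('b, 'r) rel_structure \<Rightarrow> 'd set \<Rightarrow> ('d, 'b) enc_map set \<Rightarrow>
    ('d \<Rightarrow> 'd) \<times> ('b \<Rightarrow> 'b) \<Rightarrow> bool" where
  "inner_symmetry B D F (\<rho>, \<tau>) \<longleftrightarrow>
     bij_betw \<rho> D D \<and> automorphism B \<tau> \<and> F = sym_map D (\<rho>, \<tau>) ` F"

text \<open>
  The least element in the definition of \<open>wedge_closure\<close> exists for finite structures and
  finite variable sets.
\<close>

lemma wedge_definable_all: "wedge_definable B S (S \<rightarrow>\<^sub>E universe B)"
  unfolding wedge_definable_def
  by (rule exI[of _ "[]"]) (auto simp: wedge_formula_def sat_def)

lemma wedge_definable_Int: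
  assumes "wedge_definable B S X" "wedge_definable B S Y"
  shows "wedge_definable B S (X \<inter> Y)"
proof -
  obtain \<phi> \<psi> where
    \<phi>: "wedge_formula B S \<phi>" "X = {h \<in> S \<rightarrow>\<^sub>E universe B. sat B h \<phi>}" and
    \<psi>: "wedge_formula B S \<psi>" "Y = {h \<in> S \<rightarrow>\<^sub>E universe B. sat B h \<psi>}"
    using assms unfolding wedge_definable_def by blast
  have "wedge_formula B S (\<phi> @ \<psi>)" "X \<inter> Y = {h \<in> S \<rightarrow>\<^sub>E universe B. sat B h (\<phi> @ \<psi>)}"
    using \<phi> \<psi> by (auto simp: wedge_formula_def sat_def)
  then show ?thesis unfolding wedge_definable_def by blast
qed

lemma wedge_closure_least:
  assumes "finite_structure B" "finite S" "T \<subseteq> S \<rightarrow>\<^sub>E universe B"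
  shows "wedge_definable B S (wedge_closure B S T)" "T \<subseteq> wedge_closure B S T"
    and "\<And>Y. wedge_definable B S Y \<Longrightarrow> T \<subseteq> Y \<Longrightarrow> wedge_closure B S T \<subseteq> Y"
proof -
  define P where "P = (\<lambda>X. wedge_definable B S X \<and> T \<subseteq> X)"
  have fin: "finite (S \<rightarrow>\<^sub>E universe B)"
    using assms by (auto simp: finite_structure_def intro: finite_PiE)
  have "Collect P \<subseteq> Pow (S \<rightarrow>\<^sub>E universe B)"
    by (auto simp: P_def wedge_definable_def)
  with fin have finP: "finite (Collect P)"
    by (meson finite_Pow_iff finite_subset)
  have "P (S \<rightarrow>\<^sub>E universe B)"
    using assms(3) by (simp add: P_def wedge_definable_all)
  moreover have "\<And>X Y. P X \<Longrightarrow> P Y \<Longrightarrow> P (X \<inter> Y)"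
    by (auto simp: P_def wedge_definable_Int)
  moreover have "P (\<Inter>\<C>)"
    if "finite \<C>" "\<C> \<noteq> {}" "\<C> \<subseteq> Collect P" "\<And>X Y. P X \<Longrightarrow> P Y \<Longrightarrow> P (X \<inter> Y)" for \<C>
    using that(1-3) by (induction rule: finite_ne_induct) (auto intro: that(4))
  ultimately have "P (\<Inter>(Collect P))"
    using finP by blast
  moreover have "\<And>Y. P Y \<Longrightarrow> \<Inter>(Collect P) \<subseteq> Y"
    by blast
  ultimately have "Least P = \<Inter>(Collect P)"
    by (rule Least_equality)
  then have "wedge_closure B S T = \<Inter>(Collect P)"
    by (simp add: wedge_closure_def P_def)
  with \<open>P (\<Inter>(Collect P))\<close>
  show "wedge_definable B S (wedge_closure B S T)" "T \<subseteq> wedge_closure B S T"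
    and "\<And>Y. wedge_definable B S Y \<Longrightarrow> T \<subseteq> Y \<Longrightarrow> wedge_closure B S T \<subseteq> Y"
    unfolding P_def by auto
qed

lemma finite_applications:
  assumes "finite V" "finite F"
  shows "finite (applications V F)"
proof -
  have "applications V F \<subseteq> (\<Union>p \<in> F. nlists (fst p) V \<times> {p})"
    unfolding applications_def by fastforce
  moreover have "nlists k V = {xs. set xs \<subseteq> V \<and> length xs = k}" for k
    unfolding nlists_def by blast
  then have "finite (nlists k V)" for k
    using finite_lists_length_eq[OF assms(1)] by metis
  then have "finite (\<Union>p \<in> F. nlists (fst p) V \<times> {p})"
    using assms(2) by blast
  ultimately show ?thesis
    by (rule finite_subset)
qed

lemma T_set_subset:
  assumes "encoding B D F"
  shows "T_set V D F \<subseteq> applications V F \<rightarrow>\<^sub>E universe B"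
proof
  fix t assume "t \<in> T_set V D F"
  then obtain g where g: "g \<in> V \<rightarrow>\<^sub>E D" "t = t_map V F g"
    unfolding T_set_def assignments_def by blast
  have "app_value g \<alpha> \<in> universe B" if \<alpha>: "\<alpha> \<in> applications V F" for \<alpha>
  proof -
    obtain vs k f where *: "\<alpha> = (vs, (k, f))" "(k, f) \<in> F" "vs \<in> nlists k V"
      using \<alpha> unfolding applications_def by blast
    have "map g vs \<in> nlists k D"
      using *(3) PiE_mem[OF g(1)] by (auto simp add: nlists_def simp del: nlistsE_length nlistsE_set)
    moreover have "f \<in> nlists k D \<rightarrow>\<^sub>E universe B"
      using assms *(2) unfolding encoding_def by blast
    ultimately show ?thesis
      unfolding *(1) app_value.simps by (rule PiE_mem[rotated])
  qed
  then show "t \<in> applications V F \<rightarrow>\<^sub>E universe B"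
    unfolding g(2) t_map_def by (rule restrict_PiE_iff[THEN iffD2, OF ballI])
qed

end

theory Submission
  imports Defs
begin

text \<open>
  Membership in \<open>\<langle>T\<rangle>\<close> means satisfying every atom that holds throughout \<open>T\<close>.  Precomposition with
  \<open>\<sigma>\<close> permutes the applications and satisfies \<open>t[g] \<circ> \<sigma> = \<tau> \<circ> t[\<rho> \<circ> g]\<close>.  As \<open>\<tau>\<close> preserves and
  reflects satisfaction of atoms and \<open>g \<mapsto> \<rho> \<circ> g\<close> permutes the assignments, renaming variables
  by \<open>\<sigma>\<close> permutes the atoms that hold throughout \<open>T\<^sub>V\<close>.
\<close>

text \<open>As conditional rewrite rules these make the simplifier loop once \<open>nlists_def\<close> is unfolded.\<close>

declare nlistsE_length [simp del] nlistsE_set [simp del]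

text \<open>An atom true throughout \<open>T\<close> defines, on its own, a definable set containing
  \<open>T\<close>, so the least such set lies inside it. Conversely, the closure is cut out by some
  formula, and every conjunct of that formula holds throughout \<open>T\<close>.\<close>

lemma mem_wedge_closure_iff:
  assumes "finite_structure B" "finite S" "T \<subseteq> S \<rightarrow>\<^sub>E universe B"
  shows "u \<in> wedge_closure B S T \<longleftrightarrow> u \<in> S \<rightarrow>\<^sub>E universe B \<and>
    (\<forall>a. wf_atom B S a \<longrightarrow> (\<forall>t \<in> T. sat_atom B t a) \<longrightarrow> sat_atom B u a)"
    (is "_ \<longleftrightarrow> ?R")
proof
  note closure = wedge_closure_least[OF assms]
  assume u: "u \<in> wedge_closure B S T"
  have "sat_atom B u a" if a: "wf_atom B S a" "\<forall>t \<in> T. sat_atom B t a" for a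
  proof -
    let ?X = "{h \<in> S \<rightarrow>\<^sub>E universe B. sat B h [a]}"
    have "wedge_definable B S ?X"
      unfolding wedge_definable_def using a(1)
      by (intro exI[of _ "[a]"]) (simp add: wedge_formula_def)
    moreover have "T \<subseteq> ?X"
      using a(2) assms(3) by (auto simp: sat_def)
    ultimately have "u \<in> ?X"
      using closure(3) u by blast
    then show ?thesis
      by (simp add: sat_def)
  qed
  moreover have "u \<in> S \<rightarrow>\<^sub>E universe B"
    using closure(1) u unfolding wedge_definable_def by blast
  ultimately show ?R
    by blast
next
  note closure = wedge_closure_least[OF assms]
  assume R: ?R
  obtain \<phi> where \<phi>: "wedge_formula B S \<phi>"
      "wedge_closure B S T = {h \<in> S \<rightarrow>\<^sub>E universe B. sat B h \<phi>}"
    using closure(1) unfolding wedge_definable_def by blast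
  have "sat B t \<phi>" if "t \<in> T" for t
    using closure(2) \<phi>(2) that by blast
  then have "sat B u \<phi>"
    using R \<phi>(1) unfolding sat_def wedge_formula_def by blast
  then show "u \<in> wedge_closure B S T"
    using R \<phi>(2) by blast
qed

text \<open>Used to pass between a composition and its restriction to \<open>S\<close>, since
  extensional maps require the restricted form.\<close>

lemma sat_atom_cong:
  assumes "wf_atom B S a" "\<And>x. x \<in> S \<Longrightarrow> h x = h' x"
  shows "sat_atom B h a \<longleftrightarrow> sat_atom B h' a"
proof (cases a)
  case (Rel R vs)
  with assms have "map h vs = map h' vs"
    by (auto simp: nlists_def)
  with Rel show ?thesis
    by (simp only: sat_atom.simps)
qed (use assms in auto)

lemma sat_atom_rename: "sat_atom B h (map_atom id s a) \<longleftrightarrow> sat_atom B (h \<circ> s) a"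
  by (cases a) simp_all

text \<open>For relation atoms this is the definition of an automorphism; for equalities it is
  injectivity of \<tau> on the universe, where \<open>h\<close> takes its values.\<close>

lemma sat_atom_automorphism:
  assumes "automorphism B \<tau>" "wf_atom B S a" "h \<in> S \<rightarrow> universe B"
  shows "sat_atom B (\<tau> \<circ> h) a \<longleftrightarrow> sat_atom B h a"
proof (cases a)
  case (Rel R vs)
  with assms have "R \<in> symbols B" "map h vs \<in> nlists (arity B R) (universe B)"
    by (auto simp: nlists_def)
  with assms(1) Rel show ?thesis
    by (simp add: automorphism_def)
next
  case (Eq x y)
  with assms have "inj_on \<tau> (universe B)" "h x \<in> universe B" "h y \<in> universe B"
    by (auto simp: automorphism_def bij_betw_def)
  with Eq show ?thesis
    by (simp add: inj_on_eq_iff)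
qed

lemma wf_atom_rename:
  assumes "wf_atom B S a" "s \<in> S \<rightarrow> S"
  shows "wf_atom B S (map_atom id s a)"
  using assms by (cases a) (auto simp: nlists_def)

text \<open>Renaming along the inverse permutation of \<open>S\<close> yields the required
  preimage.\<close>

lemma wf_atom_rename_surj:
  assumes "wf_atom B S a" "bij_betw s S S"
  obtains a' where "wf_atom B S a'" "a = map_atom id s a'"
proof
  let ?r = "inv_into S s"
  have r: "?r \<in> S \<rightarrow> S" "\<And>x. x \<in> S \<Longrightarrow> s (?r x) = x"
    using assms(2) by (auto simp: bij_betw_def inv_into_into f_inv_into_f)
  show "wf_atom B S (map_atom id ?r a)"
    using assms(1) r(1) by (rule wf_atom_rename)
  show "a = map_atom id s (map_atom id ?r a)"
    using assms(1) r(2) by (cases a) (auto simp: nlists_def map_idI subset_iff)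
qed

text \<open>The symmetry argument in abstract form, with \<open>s\<close> standing for the action on
  applications. The hypothesis \<open>eq\<close> is all that is needed of the maps in
  \<open>T\<close>: as sets, precomposing with \<open>s\<close> and postcomposing with \<tau> give
  the same result.\<close>

lemma wedge_closure_rename_iff:
  assumes B: "finite_structure B" and S: "finite S" and T: "T \<subseteq> S \<rightarrow>\<^sub>E universe B"
    and s: "bij_betw s S S" and \<tau>: "automorphism B \<tau>"
    and eq: "(\<lambda>t. restrict (t \<circ> s) S) ` T = (\<lambda>t. restrict (\<tau> \<circ> t) S) ` T"
    and u: "u \<in> S \<rightarrow>\<^sub>E universe B"
  shows "u \<in> wedge_closure B S T \<longleftrightarrow> restrict (u \<circ> s) S \<in> wedge_closure B S T"
proof -
  have sS: "s \<in> S \<rightarrow> S"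
    using s by (auto simp: bij_betw_def)
  have rename: "sat_atom B h (map_atom id s a) \<longleftrightarrow> sat_atom B (restrict (h \<circ> s) S) a"
    if "wf_atom B S a" for h a
    using sat_atom_cong[OF that, of "restrict (h \<circ> s) S" "h \<circ> s"] by (simp add: sat_atom_rename)
  \<comment> \<open>A renamed atom on \<open>t\<close> is the original atom on
    \<open>t \<circ> s\<close>. Over all of \<open>T\<close>, \<open>eq\<close> replaces these maps
    by \<open>\<tau> \<circ> t\<close>, and the automorphism \<tau> does not affect
    satisfaction.\<close>
  have common: "(\<forall>t \<in> T. sat_atom B t (map_atom id s a)) \<longleftrightarrow> (\<forall>t \<in> T. sat_atom B t a)"
    if a: "wf_atom B S a" for a
  proof -
    have "(\<forall>t \<in> T. sat_atom B t (map_atom id s a)) \<longleftrightarrow>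
        (\<forall>t \<in> (\<lambda>t. restrict (t \<circ> s) S) ` T. sat_atom B t a)"
      by (simp add: rename[OF a])
    also have "\<dots> \<longleftrightarrow> (\<forall>t \<in> T. sat_atom B (restrict (\<tau> \<circ> t) S) a)"
      unfolding eq by simp
    also have "\<dots> \<longleftrightarrow> (\<forall>t \<in> T. sat_atom B t a)"
    proof (rule ball_cong[OF refl])
      fix t assume "t \<in> T"
      then have "t \<in> S \<rightarrow> universe B"
        using T by (auto simp: PiE_def)
      then show "sat_atom B (restrict (\<tau> \<circ> t) S) a \<longleftrightarrow> sat_atom B t a"
        using sat_atom_automorphism[OF \<tau> a] sat_atom_cong[OF a, of "restrict (\<tau> \<circ> t) S" "\<tau> \<circ> t"]
        by simp
    qed
    finally show ?thesis .
  qed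
  have us: "restrict (u \<circ> s) S \<in> S \<rightarrow>\<^sub>E universe B"
    using u sS by auto
  \<comment> \<open>Every atom over \<open>S\<close> is a renamed one, so the test for
    \<open>u\<close> may range over renamed atoms only. By \<open>common\<close> and
    \<open>rename\<close> it then becomes the test for \<open>u \<circ> s\<close>.\<close>
  have "(\<forall>a. wf_atom B S a \<longrightarrow> (\<forall>t \<in> T. sat_atom B t a) \<longrightarrow> sat_atom B u a) \<longleftrightarrow>
      (\<forall>a. wf_atom B S a \<longrightarrow> (\<forall>t \<in> T. sat_atom B t (map_atom id s a)) \<longrightarrow>
        sat_atom B u (map_atom id s a))" (is "(\<forall>a. ?W a \<longrightarrow> ?P a) \<longleftrightarrow> ?Q")
  proof
    assume "\<forall>a. ?W a \<longrightarrow> ?P a"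
    then show ?Q
      using wf_atom_rename[OF _ sS] by blast
  next
    assume Q: ?Q
    show "\<forall>a. ?W a \<longrightarrow> ?P a"
    proof (intro allI impI)
      fix a assume a: "?W a" "\<forall>t \<in> T. sat_atom B t a"
      obtain a' where "?W a'" "a = map_atom id s a'"
        using wf_atom_rename_surj[OF a(1) s] by blast
      then show "sat_atom B u a"
        using Q a(2) by blast
    qed
  qed
  then show ?thesis
    unfolding mem_wedge_closure_iff[OF B S T] using u us common rename by auto
qed

text \<open>The variable tuple is left alone and the arity of the encoding map is kept, so a
  permutation of \<open>F\<close> lifts to the applications.\<close>

lemma bij_betw_sym_app:
  assumes "inj_on (sym_map D \<sigma>) F" "sym_map D \<sigma> ` F = F"
  shows "bij_betw (sym_app D \<sigma>) (applications V F) (applications V F)"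
proof -
  have arity: "fst (sym_map D \<sigma> p) = fst p" for p
    by (cases \<sigma>; cases p) simp
  have mem: "(vs, p) \<in> applications V F \<longleftrightarrow> p \<in> F \<and> vs \<in> nlists (fst p) V" for vs p
    by (cases p) (auto simp: applications_def)
  have "sym_app D \<sigma> = map_prod id (sym_map D \<sigma>)"
    by (rule ext) (auto simp del: sym_map.simps)
  moreover have "applications V F \<subseteq> UNIV \<times> F"
    by (auto simp: applications_def)
  ultimately have "inj_on (sym_app D \<sigma>) (applications V F)"
    using map_prod_inj_on[OF inj_on_id assms(1)] by (metis inj_on_subset)
  moreover have "sym_app D \<sigma> ` applications V F = applications V F"
  proof (intro set_eqI iffI)
    fix \<alpha> assume "\<alpha> \<in> sym_app D \<sigma> ` applications V F"
    then obtain vs p where "\<alpha> = (vs, sym_map D \<sigma> p)" "(vs, p) \<in> applications V F"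
      by auto
    then show "\<alpha> \<in> applications V F"
      using assms(2) by (auto simp: mem arity)
  next
    fix \<alpha> assume "\<alpha> \<in> applications V F"
    then obtain vs p where \<alpha>: "\<alpha> = (vs, p)" "p \<in> F" "vs \<in> nlists (fst p) V"
      by (cases \<alpha>) (auto simp: mem)
    then obtain q where q: "q \<in> F" "p = sym_map D \<sigma> q"
      using assms(2) by blast
    with \<alpha> have "(vs, q) \<in> applications V F"
      by (simp add: mem arity)
    then show "\<alpha> \<in> sym_app D \<sigma> ` applications V F"
      using \<alpha>(1) q(2) by (intro image_eqI[where x = "(vs, q)"]) simp_all
  qed
  ultimately show ?thesis
    by (simp add: bij_betw_def)
qed

text \<open>At an application of \<open>f\<close> to \<open>vs\<close>, both sides evaluate to
  \<tau> applied to \<open>f (map (\<rho> \<circ> g) vs)\<close>.\<close>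

lemma t_map_sym_app:
  assumes F: "sym_map D (\<rho>, \<tau>) ` F \<subseteq> F" and g: "g \<in> V \<rightarrow> D"
  shows "restrict (t_map V F g \<circ> sym_app D (\<rho>, \<tau>)) (applications V F) =
    restrict (\<tau> \<circ> t_map V F (restrict (\<rho> \<circ> g) V)) (applications V F)"
proof (rule restrict_ext)
  fix \<alpha> assume \<alpha>: "\<alpha> \<in> applications V F"
  then obtain vs k f where \<alpha>_eq: "\<alpha> = (vs, (k, f))" "(k, f) \<in> F" "vs \<in> nlists k V"
    unfolding applications_def by blast
  have "sym_map D (\<rho>, \<tau>) (k, f) \<in> F"
    using F \<alpha>_eq(2) by blast
  \<comment> \<open>This and the next fact ensure that the restrictions in \<open>t_map\<close> and
    \<open>sym_map\<close> are evaluated inside their domains, not at the default value.\<close>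
  then have "sym_app D (\<rho>, \<tau>) \<alpha> \<in> applications V F"
    using \<alpha>_eq by (auto simp: applications_def)
  moreover have "map g vs \<in> nlists k D"
    using \<alpha>_eq(3) g by (auto simp: nlists_def)
  moreover have "f (map (restrict (\<rho> \<circ> g) V) vs) = f (map (\<rho> \<circ> g) vs)"
    using \<alpha>_eq(3) by (intro arg_cong[of _ _ f] map_cong) (auto simp: nlists_def)
  ultimately show "(t_map V F g \<circ> sym_app D (\<rho>, \<tau>)) \<alpha> =
      (\<tau> \<circ> t_map V F (restrict (\<rho> \<circ> g) V)) \<alpha>"
    using \<alpha> by (simp add: t_map_def \<alpha>_eq(1))
qed

lemma compose_image_assignments:
  assumes "\<rho> ` D = D"
  shows "(\<lambda>g. restrict (\<rho> \<circ> g) V) ` assignments V D = assignments V D"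
proof (intro set_eqI iffI)
  fix g assume "g \<in> (\<lambda>g. restrict (\<rho> \<circ> g) V) ` assignments V D"
  moreover have "\<rho> x \<in> D" if "x \<in> D" for x
    using assms that by blast
  ultimately show "g \<in> assignments V D"
    unfolding assignments_def by (auto simp: PiE_iff)
next
  fix g assume g: "g \<in> assignments V D"
  \<comment> \<open>A preimage of \<open>g\<close>: undo \<rho> pointwise by a right inverse on
    \<open>D\<close>.\<close>
  define h where "h = restrict (inv_into D \<rho> \<circ> g) V"
  have gV: "g x \<in> \<rho> ` D" if "x \<in> V" for x
    using g that assms by (auto simp: assignments_def)
  have "h \<in> assignments V D"
    using gV by (auto simp: assignments_def h_def inv_into_into)
  moreover have "restrict (\<rho> \<circ> h) V = g"
  proof
    fix x show "restrict (\<rho> \<circ> h) V x = g x"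
    proof (cases "x \<in> V")
      case True
      then show ?thesis
        using f_inv_into_f[OF gV[OF True]] by (simp add: h_def)
    next
      case False
      then show ?thesis
        using PiE_arb[OF g[unfolded assignments_def]] by simp
    qed
  qed
  ultimately show "g \<in> (\<lambda>g. restrict (\<rho> \<circ> g) V) ` assignments V D"
    by blast
qed

theorem theorem2p8:
  fixes B :: "('b, 'r) rel_structure"
    and D :: "'d set" and F :: "('d, 'b) enc_map set"
    and \<sigma> :: "('d \<Rightarrow> 'd) \<times> ('b \<Rightarrow> 'b)"
    and V :: "'v set"
    and u u' :: "('v, 'd, 'b) application \<Rightarrow> 'b"
  assumes "finite_structure B"
    and "encoding B D F"
    and "inner_symmetry B D F \<sigma>"
    and "finite V" and "V \<noteq> {}"
    and "u \<in> applications V F \<rightarrow>\<^sub>E universe B"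
    and "u' = (\<lambda>\<alpha> \<in> applications V F. u (sym_app D \<sigma> \<alpha>))"
  shows "u \<in> wedge_closure B (applications V F) (T_set V D F) \<longleftrightarrow>
    u' \<in> wedge_closure B (applications V F) (T_set V D F)"
proof -
  let ?A = "applications V F"
  obtain \<rho> \<tau> where \<sigma>: "\<sigma> = (\<rho>, \<tau>)"
    by (cases \<sigma>)
  have \<rho>: "\<rho> ` D = D" and \<tau>: "automorphism B \<tau>" and F: "sym_map D \<sigma> ` F = F"
    using assms(3) unfolding \<sigma> by (auto simp: bij_betw_def)
  have "finite F"
    using assms(2) by (simp add: encoding_def)
  \<comment> \<open>Injectivity on \<open>F\<close> comes from finiteness:
    \<open>sym_map D \<sigma>\<close> maps the finite set \<open>F\<close> onto itself.\<close>
  then have bij: "bij_betw (sym_app D \<sigma>) ?A ?A"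
    using F by (intro bij_betw_sym_app) (simp_all add: eq_card_imp_inj_on)
  have T: "T_set V D F = t_map V F ` assignments V D"
    by (auto simp: T_set_def)
  have "(\<lambda>t. restrict (t \<circ> sym_app D \<sigma>) ?A) ` T_set V D F =
      (\<lambda>g. restrict (\<tau> \<circ> t_map V F (restrict (\<rho> \<circ> g) V)) ?A) ` assignments V D"
    unfolding T image_image
  proof (rule image_cong[OF refl])
    fix g assume "g \<in> assignments V D"
    then have "g \<in> V \<rightarrow> D"
      by (auto simp: assignments_def)
    then show "restrict (t_map V F g \<circ> sym_app D \<sigma>) ?A =
        restrict (\<tau> \<circ> t_map V F (restrict (\<rho> \<circ> g) V)) ?A"
      unfolding \<sigma> using F[unfolded \<sigma>] by (intro t_map_sym_app) simp_all
  qed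
  \<comment> \<open>Reindexing by \<open>\<rho> \<circ> g\<close>, which again runs through all
    assignments, removes \<rho>.\<close>
  also have "\<dots> = (\<lambda>g. restrict (\<tau> \<circ> t_map V F g) ?A) `
      (\<lambda>g. restrict (\<rho> \<circ> g) V) ` assignments V D"
    by (simp add: image_image)
  also have "\<dots> = (\<lambda>t. restrict (\<tau> \<circ> t) ?A) ` T_set V D F"
    unfolding compose_image_assignments[OF \<rho>] T by (simp add: image_image)
  finally have eq: "(\<lambda>t. restrict (t \<circ> sym_app D \<sigma>) ?A) ` T_set V D F =
      (\<lambda>t. restrict (\<tau> \<circ> t) ?A) ` T_set V D F" .
  have "u' = restrict (u \<circ> sym_app D \<sigma>) ?A"
    using assms(7) by (simp add: comp_def)
  then show ?thesis
    using wedge_closure_rename_iff[OF assms(1) finite_applications[OF assms(4) \<open>finite F\<close>]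
        T_set_subset[OF assms(2)] bij \<tau> eq assms(6)]
    by simp
qed

end
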